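(* Let $J(S)=\xi f(S)+\sum_{i=1}^{n}h_i(S)$ for $S\subseteq E$, where $\xi\ge 0$, $f(S)=\min_x\|A(S)x-b_0\|_2^2$ and $h_i(S)=\min_x\|A(S)x-c^i\|_2^2$. Let $\gamma_{U,k}$ denote the submodularity ratio of $J$. Then for any set $U\subseteq E$ and any integer $k\ge 1$, $$\gamma_{U,k}\ \ge\ \lambda_{\min}(C,k+|U|)\ \ge\ \lambda_{\min}(C),$$ where $C=A^TA/(2n)$, $\lambda_{\min}(C)$ is the smallest eigenvalue of $C$, and $\lambda_{\min}(C,k)$ is the smallest $k$-sparse eigenvalue of $C$, defined by $\lambda_{\min}(C,k)=\min_{S\subseteq E:\,|S|=k}\lambda_{\min}(C(S))$ with $C(S)=A(S)^TA(S)/(2n)$.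
   Context: Setting: $G(N,E)$ is a finite simple undirected graph with node set (buses) $N=\{1,\dots,m\}$ and edge set $E=\{e_1,\dots,e_l\}$. There are $n\ge1$ generators, the $i$-th located at bus $u_i\in N$; $r$ of them are reference generators, located at distinct buses $s_1,\dots,s_r$. Incidence matrix: $A$ is the $m\times l$ matrix with $(A)_{ik}=1$ if $e_k$ joins $i$ to some $j$ with $i<j$, $(A)_{ik}=-1$ if $e_k$ joins $i$ to some $j$ with $i>j$, and $(A)_{ik}=0$ otherwise. For $S\subseteq E$, $A(S)$ is the submatrix of $A$ consisting of the columns indexed by edges in $S$; the variable $x$ ranges over $\mathbb{R}^{|S|}$ (for $S=\emptyset$, $A(S)x$ is the zero vector). Data vectors: $b_0=d_0-g_0\in\mathbb{R}^m$ is a given vector (net load at each bus). $L$ is the $n\times r$ real coherency matrix $L=UU_1^{-1}$, where the columns of the real $n\times r$ matrix $U$ form a basis of the eigenspace of the $r$ smallest-magnitude eigenvalues of the system matrix, and $U_1$ is the (invertible) $r\times r$ matrix formed by the rows of $U$ of the reference generators; so the rows of $L$ corresponding to reference generators form the identity matrix. (This $U$ is unrelated to the edge set $U$ in the claim.) For a non-reference generator $i$, $c^i\in\mathbb{R}^m$ has entries $(c^i)_{u_i}=1$, $(c^i)_{s_k}=-L_{ik}$ for $k=1,\dots,r$, and $0$ elsewhere. For a reference generator $i$, $c^i=0$. Submodularity ratio: for a non-negative set function $J:2^E\to\mathbb{R}$, $U\subseteq E$ and $k\ge1$, $$\gamma_{U,k}=\min_{\substack{L,S:\ L\cap S=\emptyset,\\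 L\subseteq U,\ |S|\le k}}\frac{\sum_{z\in S}\big(J(L\cup\{z\})-J(L)\big)}{J(L\cup S)-J(L)},$$ where here $L,S$ denote subsets of $E$, and the minimum is over pairs for which the denominator is nonzero. Convention: $\lambda_{\min}(C,k)=\lambda_{\min}(C)$ if $k>|E|$. *)

theory Defs
  imports
    Complex_Main
    "HOL-Library.Extended_Real"
    "Jordan_Normal_Form.Char_Poly"
    "Jordan_Normal_Form.DL_Submatrix"
begin

(* Buses, edges, generators and reference generators are numbered from 0.  The graph on the
   buses {..<m} is given by the list es of its edges (each a 2-element set of buses); the list
   order is the order of the columns of the incidence matrix, and E = set es. *)

definition simple_graph :: "nat \<Rightarrow> nat set list \<Rightarrow> bool" where
  "simple_graph m es \<longleftrightarrow> distinct es \<and> (\<forall>e\<in>set es. e \<subseteq> {..<m} \<and> card e = 2)"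

definition incidence_mat :: "nat \<Rightarrow> nat set list \<Rightarrow> real mat" where
  "incidence_mat m es = mat m (length es) (\<lambda>(i, k).
     if \<exists>j. es ! k = {i, j} \<and> i < j then 1
     else if \<exists>j. es ! k = {i, j} \<and> i > j then - 1
     else 0)"

definition incidence_sub :: "nat \<Rightarrow> nat set list \<Rightarrow> nat set set \<Rightarrow> real mat" where
  "incidence_sub m es S = submatrix (incidence_mat m es) UNIV {k. k < length es \<and> es ! k \<in> S}"

(* The columns of the real matrix U are a basis of the (complex) span of eigenvectors belonging to
   the first r entries of the list ev of all eigenvalues of W, listed with algebraic multiplicity
   and by increasing magnitude.  Eigenvalues are taken over the complex numbers because W is not
   assumed symmetric; ties in magnitude may be broken in any way. *)

definition smallest_eigenbasis :: "nat \<Rightarrow> nat \<Rightarrow> real mat \<Rightarrow> real mat \<Rightarrow> bool" where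
  "smallest_eigenbasis n r W U \<longleftrightarrow>
     (let Wc = map_mat complex_of_real W; Uc = map_mat complex_of_real U in
      W \<in> carrier_mat n n \<and> U \<in> carrier_mat n r \<and>
      (\<exists>ev V. char_poly Wc = (\<Prod>a\<leftarrow>ev. [:- a, 1:]) \<and> sorted (map cmod ev) \<and>
         V \<in> carrier_mat n r \<and> (\<forall>k<r. eigenvector Wc (col V k) (ev ! k)) \<and>
         {Uc *\<^sub>v x | x. x \<in> carrier_vec r} = {V *\<^sub>v x | x. x \<in> carrier_vec r}) \<and>
      (\<forall>x\<in>carrier_vec r. Uc *\<^sub>v x = 0\<^sub>v n \<longrightarrow> x = 0\<^sub>v r))"

(* ref k is the generator that serves as the k-th reference generator. *)

definition coherency_mat ::
    "nat \<Rightarrow> nat \<Rightarrow> (nat \<Rightarrow> nat) \<Rightarrow> real mat \<Rightarrow> real mat \<Rightarrow> bool" where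
  "coherency_mat n r ref W L \<longleftrightarrow>
     (\<exists>U U1 U1_inv. smallest_eigenbasis n r W U \<and>
        U1 = mat r r (\<lambda>(k, j). U $$ (ref k, j)) \<and>
        U1_inv \<in> carrier_mat r r \<and> inverts_mat U1 U1_inv \<and> inverts_mat U1_inv U1 \<and>
        L = U * U1_inv)"

(* u i is the bus of generator i, so u (ref k) is the bus s_k.  Writing the entries as a difference
   of indicators gives 1 at u i, - L(i,k) at s_k and 0 elsewhere when u i is not a reference bus,
   and superposes the two contributions when it is. *)

definition coherency_vec ::
    "nat \<Rightarrow> nat \<Rightarrow> (nat \<Rightarrow> nat) \<Rightarrow> (nat \<Rightarrow> nat) \<Rightarrow> real mat \<Rightarrow> nat \<Rightarrow> real vec" where
  "coherency_vec m r u ref L i =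
     (if i \<in> ref ` {..<r} then 0\<^sub>v m
      else vec m (\<lambda>v. (if v = u i then 1 else 0) -
                      (\<Sum>k<r. if v = u (ref k) then L $$ (i, k) else 0)))"

(* min over x of the squared Euclidean norm of M x - b; the infimum is attained. *)

definition least_squares :: "real mat \<Rightarrow> real vec \<Rightarrow> real" where
  "least_squares M b =
     (INF x\<in>carrier_vec (dim_col M). (M *\<^sub>v x - b) \<bullet> (M *\<^sub>v x - b))"

definition cost ::
    "nat \<Rightarrow> nat set list \<Rightarrow> nat \<Rightarrow> real \<Rightarrow> real vec \<Rightarrow> (nat \<Rightarrow> real vec) \<Rightarrow> nat set set \<Rightarrow> real" where
  "cost m es n \<xi> b0 c S =
     \<xi> * least_squares (incidence_sub m es S) b0 +
     (\<Sum>i<n. least_squares (incidence_sub m es S) (c i))"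

(* For a finite ground set E the infimum is over finitely many ratios, hence a minimum, unless no
   pair has a nonzero denominator, in which case the value is \<infinity>. *)

definition submodularity_ratio ::
    "'a set \<Rightarrow> ('a set \<Rightarrow> real) \<Rightarrow> 'a set \<Rightarrow> nat \<Rightarrow> ereal" where
  "submodularity_ratio E J U k =
     (INF (L, S) \<in> {(L, S). L \<subseteq> U \<and> S \<subseteq> E \<and> L \<inter> S = {} \<and> card S \<le> k \<and>
                            J (L \<union> S) - J L \<noteq> 0}.
        ereal ((\<Sum>z\<in>S. J (L \<union> {z}) - J L) / (J (L \<union> S) - J L)))"

definition gram_sub :: "nat \<Rightarrow> nat set list \<Rightarrow> nat \<Rightarrow> nat set set \<Rightarrow> real mat" where
  "gram_sub m es n S =
     (1 / (2 * real n)) \<cdot>\<^sub>m ((incidence_sub m es S)\<^sup>T * incidence_sub m es S)"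

definition gram :: "nat \<Rightarrow> nat set list \<Rightarrow> nat \<Rightarrow> real mat" where
  "gram m es n = (1 / (2 * real n)) \<cdot>\<^sub>m ((incidence_mat m es)\<^sup>T * incidence_mat m es)"

(* Used for symmetric matrices only.  A 0 x 0 matrix has no eigenvalue, and its lambda_min is an
   unspecified real. *)

definition lambda_min :: "real mat \<Rightarrow> real" where
  "lambda_min M = Min {a. eigenvalue M a}"

definition sparse_lambda_min :: "nat \<Rightarrow> nat set list \<Rightarrow> nat \<Rightarrow> nat \<Rightarrow> real" where
  "sparse_lambda_min m es n k =
     (if k > card (set es) then lambda_min (gram m es n)
      else Min {lambda_min (gram_sub m es n S) | S. S \<subseteq> set es \<and> card S = k})"

end

theory Submission
  imports Defs "HOL-Analysis.Convex"
begin

text \<open>Every column of the incidence matrix has squared norm $2$. Hence, if $\rho$ is the least-squares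
  residual for the edge set $L$, adding a single edge $z$ lowers the least-squares error by at least
  $(\rho \bullet a_z)^2 / 2$ (move along $a_z$ only). Adding all of $S$ lowers it by at most
  $\sup_w \sum_z (2 w_z (\rho \bullet a_z) - 2 \lambda w_z^2)$ with $\lambda = \lambda_{\min}(C(L \cup S))$,
  because $|A w|^2 \ge 2 n \lambda |w|^2 \ge 2 \lambda |w|^2$ for $w$ supported on $L \cup S$. Multiplied by
  $\lambda$, each summand is at most $(\rho \bullet a_z)^2 / 2$ by completing the square. These
  inequalities are linear in the set function, so they add up to one for $J$. Finally, a Rayleigh
  quotient minimised over fewer coordinates is larger, so $\lambda_{\min}(C(T))$ is antitone in $T$.\<close>

unbundle no inner_syntax

subsection \<open>The smallest eigenvalue of a real symmetric matrix\<close>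

lemma scalar_prod_self_nonneg: "0 \<le> x \<bullet> (x :: real vec)"
  by (auto simp: scalar_prod_def intro: sum_nonneg)

lemma scalar_prod_self_pos:
  fixes x :: "real vec"
  assumes "x \<in> carrier_vec n" "x \<noteq> 0\<^sub>v n"
  shows "x \<bullet> x > 0"
proof -
  obtain i where i: "i < n" "x $ i \<noteq> 0"
    using assms by (metis carrier_vecD eq_vecI index_zero_vec(1,2))
  then have "0 < x $ i * x $ i"
    by (simp add: zero_less_mult_iff) linarith
  also have "\<dots> \<le> x \<bullet> x"
    unfolding scalar_prod_def using i assms(1)
    by (intro member_le_sum) auto
  finally show ?thesis .
qed

text \<open>Cauchy-Schwarz row by row; the constant is the squared Frobenius norm, plus 1 so that it
  stays positive for the zero matrix and may be divided by.\<close>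

lemma mult_mat_vec_sq_bound:
  fixes M :: "real mat"
  assumes M: "M \<in> carrier_mat nr nc"
  obtains K where "K > 0" "\<And>x. x \<in> carrier_vec nc \<Longrightarrow> (M *\<^sub>v x) \<bullet> (M *\<^sub>v x) \<le> K * (x \<bullet> x)"
proof
  define K where "K = (\<Sum>i<nr. row M i \<bullet> row M i)"
  show "1 + K > 0"
    unfolding K_def scalar_prod_def by (auto intro!: add_pos_nonneg sum_nonneg)
  fix x :: "real vec"
  assume x: "x \<in> carrier_vec nc"
  have "(row M i \<bullet> x)\<^sup>2 \<le> (row M i \<bullet> row M i) * (x \<bullet> x)" if "i < nr" for i
    using Cauchy_Schwarz_ineq_sum[of "\<lambda>j. row M i $ j" "\<lambda>j. x $ j" "{0..<nc}"] x M
    by (simp add: scalar_prod_def power2_eq_square)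
  then have "(\<Sum>i<nr. (row M i \<bullet> x)\<^sup>2) \<le> (\<Sum>i<nr. (row M i \<bullet> row M i) * (x \<bullet> x))"
    by (intro sum_mono) auto
  moreover have "(M *\<^sub>v x) \<bullet> (M *\<^sub>v x) = (\<Sum>i<nr. (row M i \<bullet> x)\<^sup>2)"
    using M by (simp add: scalar_prod_def[of "M *\<^sub>v x"] power2_eq_square lessThan_atLeast0)
  moreover have "x \<bullet> x \<ge> 0"
    by (rule scalar_prod_self_nonneg)
  ultimately show "(M *\<^sub>v x) \<bullet> (M *\<^sub>v x) \<le> (1 + K) * (x \<bullet> x)"
    by (simp add: K_def sum_distrib_right distrib_right)
qed

text \<open>Makes the \<open>Min\<close> in \<open>lambda_min\<close> a genuine minimum once an
  eigenvalue exists.\<close>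

lemma finite_eigenvalues:
  fixes M :: "'a :: field mat"
  assumes M: "M \<in> carrier_mat n n"
  shows "finite {a. eigenvalue M a}"
proof -
  have "char_poly M \<noteq> 0"
    using degree_monic_char_poly[OF M] by auto
  then show ?thesis
    by (simp add: eigenvalue_root_char_poly[OF M] poly_roots_finite)
qed

text \<open>Testing nonnegativity of the form at the gradient step \<open>x - t * B x\<close> with
  small \<open>t\<close> yields \<open>t * |B x|^2 \<le> x \<bullet> B x\<close>. This replaces an
  argument through a square root of \<open>B\<close>.\<close>

lemma psd_form_bounds_image:
  fixes B :: "real mat"
  assumes B: "B \<in> carrier_mat n n" and sym: "B\<^sup>T = B"
    and psd: "\<And>x. x \<in> carrier_vec n \<Longrightarrow> x \<bullet> (B *\<^sub>v x) \<ge> 0"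
  obtains K where "K > 0" "\<And>x. x \<in> carrier_vec n \<Longrightarrow> (B *\<^sub>v x) \<bullet> (B *\<^sub>v x) \<le> K * (x \<bullet> (B *\<^sub>v x))"
proof -
  obtain C where C: "C > 0" "\<And>x. x \<in> carrier_vec n \<Longrightarrow> (B *\<^sub>v x) \<bullet> (B *\<^sub>v x) \<le> C * (x \<bullet> x)"
    using mult_mat_vec_sq_bound[OF B] by blast
  have "(B *\<^sub>v x) \<bullet> (B *\<^sub>v x) \<le> (1 + C) * (x \<bullet> (B *\<^sub>v x))" if x: "x \<in> carrier_vec n" for x
  proof -
    define y where "y = B *\<^sub>v x"
    define z where "z = B *\<^sub>v y"
    \<comment> \<open>Chosen so that \<open>t^2 * (1 + C) = t\<close>: the quadratic term then
      absorbs only half of the linear term \<open>2 * t * (y \<bullet> y)\<close>.\<close>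
    define t where "t = 1 / (1 + C)"
    have y: "y \<in> carrier_vec n" and z: "z \<in> carrier_vec n"
      using B x by (auto simp: y_def z_def)
    have xz: "x \<bullet> z = y \<bullet> y"
      using transpose_vec_mult_scalar[OF B y x] sym
        comm_scalar_prod[OF x z] comm_scalar_prod[OF y y] by (simp add: y_def z_def)
    have "0 \<le> (x - t \<cdot>\<^sub>v y) \<bullet> (B *\<^sub>v (x - t \<cdot>\<^sub>v y))"
      using psd[of "x - t \<cdot>\<^sub>v y"] x y by simp
    also have "B *\<^sub>v (x - t \<cdot>\<^sub>v y) = y - t \<cdot>\<^sub>v z"
      using B x y by (simp add: mult_minus_distrib_mat_vec[OF B] mult_mat_vec[OF B] y_def z_def)
    also have "(x - t \<cdot>\<^sub>v y) \<bullet> (y - t \<cdot>\<^sub>v z) = x \<bullet> y - 2 * t * (y \<bullet> y) + t\<^sup>2 * (y \<bullet> z)"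
      using x y z xz
      by (simp add: minus_scalar_prod_distrib[of _ n] scalar_prod_minus_distrib[of _ n]
          algebra_simps power2_eq_square)
    finally have 1: "0 \<le> x \<bullet> y - 2 * t * (y \<bullet> y) + t\<^sup>2 * (y \<bullet> z)" .
    \<comment> \<open>The bound \<open>2 * (y \<bullet> z) \<le> |y|^2 + |z|^2\<close> controls the
      quadratic term by \<open>|y|^2\<close>, since \<open>z = B y\<close>.\<close>
    have "0 \<le> (y - z) \<bullet> (y - z)"
      by (rule scalar_prod_self_nonneg)
    also have "\<dots> = y \<bullet> y - 2 * (y \<bullet> z) + z \<bullet> z"
      using x y z comm_scalar_prod[OF y z]
      by (simp add: minus_scalar_prod_distrib[of _ n] scalar_prod_minus_distrib[of _ n])
    finally have "2 * (y \<bullet> z) \<le> y \<bullet> y + C * (y \<bullet> y)"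
      using C(2)[OF y] by (simp add: z_def)
    moreover have "0 \<le> (1 + C) * (y \<bullet> y)"
      using C(1) scalar_prod_self_nonneg[of y] by simp
    ultimately have "y \<bullet> z \<le> (1 + C) * (y \<bullet> y)"
      by (simp add: algebra_simps)
    then have "t\<^sup>2 * (y \<bullet> z) \<le> t\<^sup>2 * ((1 + C) * (y \<bullet> y))"
      by (intro mult_left_mono) auto
    also have "\<dots> = t * (y \<bullet> y)"
      using C(1) by (simp add: t_def power2_eq_square)
    finally have "t * (y \<bullet> y) \<le> x \<bullet> y"
      using 1 by simp
    then show ?thesis
      using C(1) by (simp add: t_def y_def field_simps)
  qed
  then show ?thesis
    using C(1) that[of "1 + C"] by simp
qed

text \<open>The infimum $\mu$ of the Rayleigh quotient is an eigenvalue: otherwise $B = M - \mu I$ would be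
  invertible and positive semidefinite, so $|x|^2 \le K' |Bx|^2 \le K' K \, (x \bullet Bx)$, and the
  quotient would stay above $\mu + 1/(K'K)$. No compactness argument is needed.\<close>

lemma lambda_min_rayleigh:
  fixes M :: "real mat"
  assumes M: "M \<in> carrier_mat n n" and sym: "M\<^sup>T = M" and n: "n > 0"
  shows "\<And>x. x \<in> carrier_vec n \<Longrightarrow> lambda_min M * (x \<bullet> x) \<le> x \<bullet> (M *\<^sub>v x)"
    and "eigenvalue M (lambda_min M)"
proof -
  define R where "R = (\<lambda>x. (x \<bullet> (M *\<^sub>v x)) / (x \<bullet> x)) ` (carrier_vec n - {0\<^sub>v n})"
  define \<mu> where "\<mu> = Inf R"
  define B where "B = M - \<mu> \<cdot>\<^sub>m 1\<^sub>m n"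
  have "unit_vec n 0 \<in> carrier_vec n - {0\<^sub>v n :: real vec}"
    using n by auto
  then have R_ne: "R \<noteq> {}"
    unfolding R_def by blast
  obtain C where C: "C > 0" "\<And>x. x \<in> carrier_vec n \<Longrightarrow> (M *\<^sub>v x) \<bullet> (M *\<^sub>v x) \<le> C * (x \<bullet> x)"
    using mult_mat_vec_sq_bound[OF M] by blast
  have R_bdd: "bdd_below R"
  proof (rule bdd_belowI)
    fix a assume "a \<in> R"
    then obtain x where x: "x \<in> carrier_vec n" "x \<noteq> 0\<^sub>v n" and a: "a = (x \<bullet> (M *\<^sub>v x)) / (x \<bullet> x)"
      by (auto simp: R_def)
    have Mx: "M *\<^sub>v x \<in> carrier_vec n"
      using M x by simp
    \<comment> \<open>Expanding this square bounds \<open>x \<bullet> M x\<close> below by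
      \<open>-(|x|^2 + |M x|^2) / 2\<close>, whence the constant
      \<open>-(1 + C) / 2\<close>.\<close>
    have "0 \<le> (x + M *\<^sub>v x) \<bullet> (x + M *\<^sub>v x)"
      by (rule scalar_prod_self_nonneg)
    also have "\<dots> = x \<bullet> x + 2 * (x \<bullet> (M *\<^sub>v x)) + (M *\<^sub>v x) \<bullet> (M *\<^sub>v x)"
      using x Mx comm_scalar_prod[OF x(1) Mx]
      by (simp add: add_scalar_prod_distrib[of _ n] scalar_prod_add_distrib[of _ n])
    finally have "- (1 + C) / 2 * (x \<bullet> x) \<le> x \<bullet> (M *\<^sub>v x)"
      using C(2)[OF x(1)] by (simp add: algebra_simps)
    then show "- (1 + C) / 2 \<le> a"
      using scalar_prod_self_pos[OF x] by (simp add: a pos_le_divide_eq)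
  qed
  have \<mu>_le: "\<mu> * (x \<bullet> x) \<le> x \<bullet> (M *\<^sub>v x)" if x: "x \<in> carrier_vec n" for x
  proof (cases "x = 0\<^sub>v n")
    case True
    then show ?thesis using M by simp
  next
    case False
    then have "\<mu> \<le> (x \<bullet> (M *\<^sub>v x)) / (x \<bullet> x)"
      using x R_bdd by (auto simp: \<mu>_def R_def intro: cInf_lower)
    then show ?thesis
      using scalar_prod_self_pos[OF x False] by (simp add: pos_le_divide_eq)
  qed
  have B: "B \<in> carrier_mat n n"
    using M by (auto simp: B_def intro: minus_carrier_mat)
  have "B\<^sup>T = M\<^sup>T - \<mu> \<cdot>\<^sub>m 1\<^sub>m n"
    using M by (intro eq_matI) (auto simp: B_def)
  then have B_sym: "B\<^sup>T = B"
    by (simp add: sym B_def)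
  have B_vec: "B *\<^sub>v x = M *\<^sub>v x - \<mu> \<cdot>\<^sub>v x" if x: "x \<in> carrier_vec n" for x
  proof -
    have "(\<mu> \<cdot>\<^sub>m 1\<^sub>m n) *\<^sub>v x = \<mu> \<cdot>\<^sub>v x"
      using x by (intro eq_vecI) auto
    then show ?thesis
      using minus_mult_distrib_mat_vec[OF M _ x, of "\<mu> \<cdot>\<^sub>m 1\<^sub>m n"] by (simp add: B_def)
  qed
  have B_form: "x \<bullet> (B *\<^sub>v x) = x \<bullet> (M *\<^sub>v x) - \<mu> * (x \<bullet> x)" if x: "x \<in> carrier_vec n" for x
    using x M by (simp add: B_vec scalar_prod_minus_distrib[of _ n])
  have "det B = 0"
  proof (rule ccontr)
    assume "det B \<noteq> 0"
    from det_non_zero_imp_unit[OF B this, of "()"]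
    obtain B' where B': "B' \<in> carrier_mat n n" "B' * B = 1\<^sub>m n"
      by (auto simp: Units_def ring_mat_def)
    obtain K where K: "K > 0" "\<And>x. x \<in> carrier_vec n \<Longrightarrow> (B *\<^sub>v x) \<bullet> (B *\<^sub>v x) \<le> K * (x \<bullet> (B *\<^sub>v x))"
      using psd_form_bounds_image[OF B B_sym] \<mu>_le B_form by (metis diff_ge_0_iff_ge)
    obtain K' where K': "K' > 0" "\<And>x. x \<in> carrier_vec n \<Longrightarrow> (B' *\<^sub>v x) \<bullet> (B' *\<^sub>v x) \<le> K' * (x \<bullet> x)"
      using mult_mat_vec_sq_bound[OF B'(1)] by blast
    have "\<mu> + 1 / (K' * K) \<le> a" if "a \<in> R" for a
    proof -
      from that obtain x where x: "x \<in> carrier_vec n" "x \<noteq> 0\<^sub>v n"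
        and a: "a = (x \<bullet> (M *\<^sub>v x)) / (x \<bullet> x)"
        by (auto simp: R_def)
      have "x = B' *\<^sub>v (B *\<^sub>v x)"
        using assoc_mult_mat_vec[OF B'(1) B x(1)] B'(2) x by simp
      then have "x \<bullet> x \<le> K' * ((B *\<^sub>v x) \<bullet> (B *\<^sub>v x))"
        using K'(2)[of "B *\<^sub>v x"] B x by simp
      also have "\<dots> \<le> K' * (K * (x \<bullet> (B *\<^sub>v x)))"
        using K(2)[OF x(1)] K'(1) by simp
      finally have "(\<mu> + 1 / (K' * K)) * (x \<bullet> x) \<le> x \<bullet> (M *\<^sub>v x)"
        using K(1) K'(1) B_form[OF x(1)] by (simp add: field_simps)
      then show ?thesis
        using scalar_prod_self_pos[OF x] by (simp add: a pos_le_divide_eq)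
    qed
    then have "\<mu> + 1 / (K' * K) \<le> \<mu>"
      using R_ne unfolding \<mu>_def by (intro cInf_greatest) auto
    then show False
      using K(1) K'(1) by (simp add: field_simps)
  qed
  then obtain v where v: "v \<in> carrier_vec n" "v \<noteq> 0\<^sub>v n" "B *\<^sub>v v = 0\<^sub>v n"
    using det_0_iff_vec_prod_zero_field[OF B] by auto
  have "M *\<^sub>v v = \<mu> \<cdot>\<^sub>v v"
  proof (rule eq_vecI)
    fix i assume "i < dim_vec (\<mu> \<cdot>\<^sub>v v)"
    then have "i < n" "(B *\<^sub>v v) $ i = 0"
      using v by auto
    then show "(M *\<^sub>v v) $ i = (\<mu> \<cdot>\<^sub>v v) $ i"
      unfolding B_vec[OF v(1)] using v M by simp
  qed (use v M in auto)
  then have \<mu>_eig: "eigenvalue M \<mu>"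
    using v M unfolding eigenvalue_def eigenvector_def by auto
  \<comment> \<open>Every eigenvalue is the Rayleigh quotient of its eigenvector, so the eigenvalue
    \<mu> is the smallest one.\<close>
  have "\<mu> \<le> a" if "eigenvalue M a" for a
  proof -
    from that obtain w where w: "w \<in> carrier_vec n" "w \<noteq> 0\<^sub>v n" "M *\<^sub>v w = a \<cdot>\<^sub>v w"
      using M unfolding eigenvalue_def eigenvector_def by auto
    then have "\<mu> * (w \<bullet> w) \<le> a * (w \<bullet> w)"
      using \<mu>_le[OF w(1)] by simp
    then show ?thesis
      using scalar_prod_self_pos[OF w(1,2)] by simp
  qed
  then have "lambda_min M = \<mu>"
    unfolding lambda_min_def using finite_eigenvalues[OF M] \<mu>_eig by (intro Min_eqI) auto
  then show "eigenvalue M (lambda_min M)"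
    and "\<And>x. x \<in> carrier_vec n \<Longrightarrow> lambda_min M * (x \<bullet> x) \<le> x \<bullet> (M *\<^sub>v x)"
    using \<mu>_eig \<mu>_le by simp_all
qed

text \<open>An eigenvector for \<open>lambda_min M\<close> has exactly this value as its Rayleigh
  quotient.\<close>

lemma lambda_min_ge:
  fixes M :: "real mat"
  assumes M: "M \<in> carrier_mat n n" and sym: "M\<^sup>T = M" and n: "n > 0"
    and le: "\<And>x. x \<in> carrier_vec n \<Longrightarrow> c * (x \<bullet> x) \<le> x \<bullet> (M *\<^sub>v x)"
  shows "c \<le> lambda_min M"
proof -
  obtain v where v: "v \<in> carrier_vec n" "v \<noteq> 0\<^sub>v n" "M *\<^sub>v v = lambda_min M \<cdot>\<^sub>v v"
    using lambda_min_rayleigh(2)[OF M sym n] M unfolding eigenvalue_def eigenvector_def by auto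
  then have "c * (v \<bullet> v) \<le> lambda_min M * (v \<bullet> v)"
    using le[OF v(1)] by simp
  then show ?thesis
    using scalar_prod_self_pos[OF v(1,2)] by simp
qed

subsection \<open>Least squares over a set of columns\<close>

text \<open>Coefficient vectors of a column submatrix are extended by zero, so that all column sets share
  the one matrix \<open>A\<close> and inclusion of column sets becomes inclusion of coefficient sets.\<close>

definition supp_vec :: "nat \<Rightarrow> nat set \<Rightarrow> real vec set" where
  "supp_vec l I = {y \<in> carrier_vec l. \<forall>k<l. k \<notin> I \<longrightarrow> y $ k = 0}"

text \<open>Turns sums over the columns of a submatrix into sums over the original column
  indices.\<close>

lemma bij_betw_pick:
  assumes "finite I"
  shows "bij_betw (pick I) {..<card I} I"
proof -
  have "inj_on (pick I) {..<card I}"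
    by (rule inj_onI) (metis card_pick lessThan_iff)
  moreover have "pick I ` {..<card I} \<subseteq> I"
    using pick_in_set_le by auto
  ultimately show ?thesis
    using assms by (simp add: bij_betw_def card_image card_subset_eq)
qed

lemma submatrix_cols_carrier:
  assumes "A \<in> carrier_mat m l" "I \<subseteq> {..<l}"
  shows "submatrix A UNIV I \<in> carrier_mat m (card I)"
proof -
  have "{j. j < l \<and> j \<in> I} = I" using assms(2) by auto
  then show ?thesis using assms(1) unfolding carrier_mat_def by (simp add: dim_submatrix)
qed

text \<open>Entries of \<open>y\<close> outside \<open>I\<close> vanish, so sums over all columns
  collapse to sums over \<open>I\<close>. Norms are preserved as well, so Rayleigh quotients carry
  over.\<close>

lemma submatrix_cols_restrict:
  assumes A: "A \<in> carrier_mat m l" and I: "I \<subseteq> {..<l}" and y: "y \<in> supp_vec l I"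
  defines "x \<equiv> vec (card I) (\<lambda>j. y $ pick I j)"
  shows "submatrix A UNIV I *\<^sub>v x = A *\<^sub>v y" "x \<bullet> x = y \<bullet> y"
proof -
  have fin: "finite I" using I finite_subset by blast
  have II: "{j. j < l \<and> j \<in> I} = I" using I by auto
  have yl: "dim_vec y = l" using y by (auto simp: supp_vec_def)
  have restrict: "(\<Sum>j\<in>{0..<card I}. g (pick I j) * y $ pick I j) = (\<Sum>k\<in>{0..<l}. g k * y $ k)" for g
  proof -
    have "(\<Sum>j\<in>{0..<card I}. g (pick I j) * y $ pick I j) = (\<Sum>k\<in>I. g k * y $ k)"
      using sum.reindex_bij_betw[OF bij_betw_pick[OF fin], of "\<lambda>k. g k * y $ k"]
      by (simp add: lessThan_atLeast0)
    also have "\<dots> = (\<Sum>k\<in>{0..<l}. g k * y $ k)"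
      using I y by (intro sum.mono_neutral_left) (auto simp: supp_vec_def)
    finally show ?thesis .
  qed
  show "x \<bullet> x = y \<bullet> y"
    using restrict[of "\<lambda>k. y $ k"] yl by (simp add: x_def scalar_prod_def)
  show "submatrix A UNIV I *\<^sub>v x = A *\<^sub>v y"
  proof (rule eq_vecI)
    fix i assume "i < dim_vec (A *\<^sub>v y)"
    then have i: "i < m" using A by simp
    have "(submatrix A UNIV I *\<^sub>v x) $ i = (\<Sum>j\<in>{0..<card I}. A $$ (i, pick I j) * y $ pick I j)"
      using A II i by (simp add: dim_submatrix scalar_prod_def x_def submatrix_index pick_UNIV)
    also have "\<dots> = (A *\<^sub>v y) $ i"
      using A i yl restrict[of "\<lambda>k. A $$ (i, k)"] by (simp add: scalar_prod_def)
    finally show "(submatrix A UNIV I *\<^sub>v x) $ i = (A *\<^sub>v y) $ i" .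
  qed (use A II in \<open>auto simp: dim_submatrix\<close>)
qed

lemma supp_vec_extend:
  assumes I: "I \<subseteq> {..<l}" and x: "x \<in> carrier_vec (card I)"
  obtains y where "y \<in> supp_vec l I" "x = vec (card I) (\<lambda>j. y $ pick I j)"
proof
  have fin: "finite I" using I finite_subset by blast
  \<comment> \<open>The rank of \<open>k\<close> in \<open>I\<close> is the inverse of
    \<open>pick I\<close>.\<close>
  define y where "y = vec l (\<lambda>k. if k \<in> I then x $ card {a \<in> I. a < k} else 0)"
  show "y \<in> supp_vec l I" by (auto simp: y_def supp_vec_def)
  have "pick I j \<in> I" "pick I j < l" "card {a \<in> I. a < pick I j} = j" if "j < card I" for j
    using that I pick_in_set_le[of j I] by (auto simp: card_pick)
  then show "x = vec (card I) (\<lambda>j. y $ pick I j)"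
    using x by (intro eq_vecI) (auto simp: y_def)
qed

lemma supp_vec_mono: "I \<subseteq> T \<Longrightarrow> supp_vec l I \<subseteq> supp_vec l T"
  by (auto simp: supp_vec_def)

text \<open>Both infima range over the same set of attainable vectors: restriction and extension by
  zero are inverse to each other.\<close>

lemma least_squares_cols:
  assumes A: "A \<in> carrier_mat m l" and I: "I \<subseteq> {..<l}"
  shows "least_squares (submatrix A UNIV I) b
    = (INF y\<in>supp_vec l I. (A *\<^sub>v y - b) \<bullet> (A *\<^sub>v y - b))"
proof -
  let ?res = "\<lambda>z. (z - b) \<bullet> (z - b)"
  have "(\<lambda>x. submatrix A UNIV I *\<^sub>v x) ` carrier_vec (card I) = (\<lambda>y. A *\<^sub>v y) ` supp_vec l I"
  proof (intro equalityI image_subsetI)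
    fix x :: "real vec"
    assume "x \<in> carrier_vec (card I)"
    then obtain y where "y \<in> supp_vec l I" "x = vec (card I) (\<lambda>j. y $ pick I j)"
      by (rule supp_vec_extend[OF I])
    then show "submatrix A UNIV I *\<^sub>v x \<in> (\<lambda>y. A *\<^sub>v y) ` supp_vec l I"
      using submatrix_cols_restrict(1)[OF A I] by auto
  next
    fix y assume "y \<in> supp_vec l I"
    from submatrix_cols_restrict(1)[OF A I this]
    show "A *\<^sub>v y \<in> (\<lambda>x. submatrix A UNIV I *\<^sub>v x) ` carrier_vec (card I)"
      by (metis imageI vec_carrier)
  qed
  then have "?res ` (\<lambda>x. submatrix A UNIV I *\<^sub>v x) ` carrier_vec (card I)
      = ?res ` (\<lambda>y. A *\<^sub>v y) ` supp_vec l I"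
    by simp
  then show ?thesis
    using submatrix_cols_carrier[OF A I] by (simp add: least_squares_def image_image)
qed

lemma least_squares_cols_le:
  assumes "A \<in> carrier_mat m l" "I \<subseteq> {..<l}" "y \<in> supp_vec l I"
  shows "least_squares (submatrix A UNIV I) b \<le> (A *\<^sub>v y - b) \<bullet> (A *\<^sub>v y - b)"
  unfolding least_squares_cols[OF assms(1,2)] using assms(3)
  by (intro cINF_lower bdd_belowI[of _ 0]) (auto simp: scalar_prod_self_nonneg)

text \<open>Near-minimisers are enough for the later estimates, so no minimiser has to be
  constructed.\<close>

lemma least_squares_cols_approx:
  assumes "A \<in> carrier_mat m l" "I \<subseteq> {..<l}" "\<epsilon> > 0"
  obtains y where "y \<in> supp_vec l I"
    "(A *\<^sub>v y - b) \<bullet> (A *\<^sub>v y - b) < least_squares (submatrix A UNIV I) b + \<epsilon>"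
proof -
  let ?R = "(\<lambda>y. (A *\<^sub>v y - b) \<bullet> (A *\<^sub>v y - b)) ` supp_vec l I"
  have "0\<^sub>v l \<in> supp_vec l I" by (auto simp: supp_vec_def)
  then have "?R \<noteq> {}" by blast
  moreover have "Inf ?R < least_squares (submatrix A UNIV I) b + \<epsilon>"
    using assms by (simp add: least_squares_cols)
  ultimately show ?thesis
    using that cInf_lessD by (metis (no_types, lifting) imageE)
qed

lemma least_squares_cols_antimono:
  assumes A: "A \<in> carrier_mat m l" and T: "T \<subseteq> {..<l}" and IT: "I \<subseteq> T"
  shows "least_squares (submatrix A UNIV T) b \<le> least_squares (submatrix A UNIV I) b"
proof (rule field_le_epsilon)
  fix \<epsilon> :: real assume "\<epsilon> > 0"
  then obtain y where "y \<in> supp_vec l I"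
    "(A *\<^sub>v y - b) \<bullet> (A *\<^sub>v y - b) < least_squares (submatrix A UNIV I) b + \<epsilon>"
    using least_squares_cols_approx[OF A] IT T by (metis subset_trans)
  then show "least_squares (submatrix A UNIV T) b \<le> least_squares (submatrix A UNIV I) b + \<epsilon>"
    using least_squares_cols_le[OF A T, of y b] supp_vec_mono[OF IT, of l] by force
qed

lemma mult_mat_vec_unit:
  fixes A :: "'a :: comm_semiring_1 mat"
  assumes "A \<in> carrier_mat m l" "k < l"
  shows "A *\<^sub>v unit_vec l k = col A k"
  using assms by (intro eq_vecI) auto

section \<open>Gain from one column and from a set of columns\<close>

text \<open>A line search along column \<open>k\<close> from an arbitrary \<open>y\<close> supported
  on \<open>I\<close> gives one admissible competitor for \<open>insert k I\<close>.\<close>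

lemma least_squares_insert_col:
  assumes A: "A \<in> carrier_mat m l" and I: "I \<subseteq> {..<l}" and b: "b \<in> carrier_vec m"
    and k: "k < l" and norm: "col A k \<bullet> col A k = 2" and y: "y \<in> supp_vec l I"
  shows "((A *\<^sub>v y - b) \<bullet> col A k)\<^sup>2 / 2
    \<le> (A *\<^sub>v y - b) \<bullet> (A *\<^sub>v y - b) - least_squares (submatrix A UNIV (insert k I)) b"
proof -
  define \<rho> where "\<rho> = A *\<^sub>v y - b"
  define p where "p = \<rho> \<bullet> col A k"
  \<comment> \<open>As the column has squared norm 2, the residual after a step of length
    \<open>s\<close> is \<open>|\<rho>|^2 - 2 * s * p + 2 * s^2\<close>, which is smallest at
    \<open>s = p / 2\<close>.\<close>
  define z where "z = y - (p / 2) \<cdot>\<^sub>v unit_vec l k"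
  have yc: "y \<in> carrier_vec l" using y by (auto simp: supp_vec_def)
  have \<rho>: "\<rho> \<in> carrier_vec m" and c: "col A k \<in> carrier_vec m"
    using A b yc k by (auto simp: \<rho>_def)
  have z: "z \<in> supp_vec l (insert k I)"
    using y k by (auto simp: supp_vec_def z_def unit_vec_def)
  have "A *\<^sub>v z = A *\<^sub>v y - (p / 2) \<cdot>\<^sub>v col A k"
    using A yc k by (simp add: z_def mult_minus_distrib_mat_vec[OF A] mult_mat_vec[OF A] mult_mat_vec_unit[OF A])
  then have "A *\<^sub>v z - b = \<rho> - (p / 2) \<cdot>\<^sub>v col A k"
    using A b yc k by (intro eq_vecI) (auto simp: \<rho>_def)
  then have "(A *\<^sub>v z - b) \<bullet> (A *\<^sub>v z - b) = \<rho> \<bullet> \<rho> - p\<^sup>2 / 2"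
    using \<rho> c norm comm_scalar_prod[OF \<rho> c]
    by (simp add: minus_scalar_prod_distrib[of _ m] scalar_prod_minus_distrib[of _ m] power2_eq_square
        flip: p_def)
  moreover have "least_squares (submatrix A UNIV (insert k I)) b \<le> (A *\<^sub>v z - b) \<bullet> (A *\<^sub>v z - b)"
    using I k z by (intro least_squares_cols_le[OF A]) auto
  ultimately show ?thesis by (simp add: \<rho>_def p_def)
qed

lemma scalar_prod_mult_mat_vec_cols:
  fixes A :: "real mat"
  assumes A: "A \<in> carrier_mat m l" and T: "T \<subseteq> {..<l}" and \<rho>: "\<rho> \<in> carrier_vec m"
    and w: "w \<in> supp_vec l T"
  shows "\<rho> \<bullet> (A *\<^sub>v w) = (\<Sum>k\<in>T. w $ k * (\<rho> \<bullet> col A k))"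
proof -
  have wc: "w \<in> carrier_vec l" using w by (auto simp: supp_vec_def)
  have "\<rho> \<bullet> (A *\<^sub>v w) = (A\<^sup>T *\<^sub>v \<rho>) \<bullet> w"
    using transpose_vec_mult_scalar[OF A wc \<rho>] by simp
  also have "\<dots> = (\<Sum>k\<in>{0..<l}. w $ k * (\<rho> \<bullet> col A k))"
    using A wc \<rho> comm_scalar_prod[OF \<rho> col_carrier_vec]
    by (auto simp: scalar_prod_def[of _ w] mult.commute intro!: sum.cong)
  also have "\<dots> = (\<Sum>k\<in>T. w $ k * (\<rho> \<bullet> col A k))"
    using T w by (intro sum.mono_neutral_right) (auto simp: supp_vec_def)
  finally show ?thesis .
qed

lemma supp_vec_self_prod:
  assumes "w \<in> supp_vec l T" "T \<subseteq> {..<l}"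
  shows "w \<bullet> w = (\<Sum>k\<in>T. (w $ k)\<^sup>2)"
proof -
  have "w \<bullet> w = (\<Sum>k\<in>{0..<l}. (w $ k)\<^sup>2)"
    using assms by (auto simp: scalar_prod_def supp_vec_def power2_eq_square)
  also have "\<dots> = (\<Sum>k\<in>T. (w $ k)\<^sup>2)"
    using assms by (intro sum.mono_neutral_right) (auto simp: supp_vec_def)
  finally show ?thesis .
qed

text \<open>With near-minimisers instead of minimisers the residual \<open>\<rho>\<close> is only almost orthogonal to the
  columns in \<open>I\<close>. Therefore the sum runs over all of \<open>T\<close>, where the columns in \<open>I\<close> contribute
  \<open>f I - f (insert k I) = 0\<close>, at the price of an error proportional to \<open>\<epsilon>\<close>.\<close>

lemma least_squares_weak_submodular:
  assumes A: "A \<in> carrier_mat m l" and T: "T \<subseteq> {..<l}" and IT: "I \<subseteq> T"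
    and b: "b \<in> carrier_vec m"
    and norm: "\<And>k. k < l \<Longrightarrow> col A k \<bullet> col A k = 2"
    and \<mu>: "0 \<le> \<mu>"
    and coercive: "\<And>w. w \<in> supp_vec l T \<Longrightarrow> 2 * \<mu> * (w \<bullet> w) \<le> (A *\<^sub>v w) \<bullet> (A *\<^sub>v w)"
  defines "f \<equiv> \<lambda>I. least_squares (submatrix A UNIV I) b"
  shows "\<mu> * (f I - f T) \<le> (\<Sum>k\<in>T. f I - f (insert k I))"
proof -
  define S where "S = (\<Sum>k\<in>T. f I - f (insert k I))"
  have I: "I \<subseteq> {..<l}" using IT T by blast
  \<comment> \<open>The error has two sources: each of the \<open>card T\<close> single-column gains
    loses \<epsilon> through \<open>x\<close>, and the value at \<open>T\<close> loses \<epsilon>,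
    weighted by \<mu>, through \<open>y\<close>.\<close>
  have near: "\<mu> * (f I - f T) \<le> S + (real (card T) + \<mu>) * \<epsilon>" if \<epsilon>: "\<epsilon> > 0" for \<epsilon>
  proof -
    obtain x where x: "x \<in> supp_vec l I" "(A *\<^sub>v x - b) \<bullet> (A *\<^sub>v x - b) < f I + \<epsilon>"
      using least_squares_cols_approx[OF A I \<epsilon>] unfolding f_def .
    obtain y where y: "y \<in> supp_vec l T" "(A *\<^sub>v y - b) \<bullet> (A *\<^sub>v y - b) < f T + \<epsilon>"
      using least_squares_cols_approx[OF A T \<epsilon>] unfolding f_def .
    define \<rho> where "\<rho> = A *\<^sub>v x - b"
    define w where "w = y - x"
    define p where "p k = \<rho> \<bullet> col A k" for k
    have xc: "x \<in> carrier_vec l" and yc: "y \<in> carrier_vec l"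
      using x(1) y(1) by (auto simp: supp_vec_def)
    have \<rho>: "\<rho> \<in> carrier_vec m" and Aw: "A *\<^sub>v w \<in> carrier_vec m"
      using A b xc yc by (auto simp: \<rho>_def w_def)
    have w: "w \<in> supp_vec l T"
      using x(1) y(1) IT by (auto simp: supp_vec_def w_def)
    have "A *\<^sub>v y - b = \<rho> + A *\<^sub>v w"
      unfolding w_def mult_minus_distrib_mat_vec[OF A yc xc]
      using A b by (intro eq_vecI) (simp_all add: \<rho>_def)
    then have "(A *\<^sub>v y - b) \<bullet> (A *\<^sub>v y - b)
        = \<rho> \<bullet> \<rho> + 2 * (\<rho> \<bullet> (A *\<^sub>v w)) + (A *\<^sub>v w) \<bullet> (A *\<^sub>v w)"
      using \<rho> Aw comm_scalar_prod[OF \<rho> Aw]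
      by (simp add: add_scalar_prod_distrib[of _ m] scalar_prod_add_distrib[of _ m])
    \<comment> \<open>Coercivity replaces the quadratic form of \<open>A\<close> by a diagonal one,
      so that the drop splits into one term per column.\<close>
    also have "\<dots> \<ge> \<rho> \<bullet> \<rho> + 2 * (\<rho> \<bullet> (A *\<^sub>v w)) + 2 * \<mu> * (w \<bullet> w)"
      using coercive[OF w] by simp
    also have "\<rho> \<bullet> (A *\<^sub>v w) = (\<Sum>k\<in>T. w $ k * p k)"
      unfolding p_def by (rule scalar_prod_mult_mat_vec_cols[OF A T \<rho> w])
    also have "w \<bullet> w = (\<Sum>k\<in>T. (w $ k)\<^sup>2)"
      by (rule supp_vec_self_prod[OF w T])
    finally have "\<rho> \<bullet> \<rho> - (A *\<^sub>v y - b) \<bullet> (A *\<^sub>v y - b)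
        \<le> (\<Sum>k\<in>T. - 2 * (w $ k * p k) - 2 * \<mu> * (w $ k)\<^sup>2)"
      by (simp add: sum_subtractf sum_distrib_left sum_negf)
    then have "\<mu> * (\<rho> \<bullet> \<rho> - (A *\<^sub>v y - b) \<bullet> (A *\<^sub>v y - b))
        \<le> \<mu> * (\<Sum>k\<in>T. - 2 * (w $ k * p k) - 2 * \<mu> * (w $ k)\<^sup>2)"
      using \<mu> by (rule mult_left_mono)
    also have "\<dots> = (\<Sum>k\<in>T. \<mu> * (- 2 * (w $ k * p k) - 2 * \<mu> * (w $ k)\<^sup>2))"
      by (rule sum_distrib_left)
    also have "\<dots> \<le> (\<Sum>k\<in>T. (p k)\<^sup>2 / 2)"
    proof (rule sum_mono)
      fix k
      \<comment> \<open>The right side minus the left side is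
        \<open>(p k + 2 * \<mu> * w $ k)^2 / 2\<close>. Having multiplied by \<mu> beforehand avoids
        dividing by it, so \<open>\<mu> = 0\<close> is covered.\<close>
      show "\<mu> * (- 2 * (w $ k * p k) - 2 * \<mu> * (w $ k)\<^sup>2) \<le> (p k)\<^sup>2 / 2"
        using zero_le_power2[of "p k + 2 * \<mu> * w $ k"]
        by (simp add: power2_eq_square algebra_simps)
    qed
    also have "\<dots> \<le> (\<Sum>k\<in>T. f I - f (insert k I) + \<epsilon>)"
    proof (rule sum_mono)
      fix k assume "k \<in> T"
      then have "k < l" using T by auto
      from least_squares_insert_col[OF A I b this norm[OF this] x(1)]
      show "(p k)\<^sup>2 / 2 \<le> f I - f (insert k I) + \<epsilon>"
        using x(2) by (simp add: p_def \<rho>_def f_def)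
    qed
    also have "\<dots> = S + card T * \<epsilon>"
      by (simp add: S_def sum.distrib)
    finally have "\<mu> * (\<rho> \<bullet> \<rho> - (A *\<^sub>v y - b) \<bullet> (A *\<^sub>v y - b)) \<le> S + card T * \<epsilon>" .
    moreover have "f I \<le> \<rho> \<bullet> \<rho>"
      unfolding f_def \<rho>_def by (rule least_squares_cols_le[OF A I x(1)])
    then have "\<mu> * (f I - f T - \<epsilon>) \<le> \<mu> * (\<rho> \<bullet> \<rho> - (A *\<^sub>v y - b) \<bullet> (A *\<^sub>v y - b))"
      using y(2) \<mu> by (intro mult_left_mono) auto
    ultimately show ?thesis by (simp add: algebra_simps)
  qed
  have "\<mu> * (f I - f T) \<le> S + \<delta>" if \<delta>: "\<delta> > 0" for \<delta>
  proof -
    \<comment> \<open>The summand 1 keeps the denominator positive when \<open>T\<close> is empty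
      and \<open>\<mu> = 0\<close>.\<close>
    have pos: "real (card T) + \<mu> + 1 > 0" using \<mu> by linarith
    have "(real (card T) + \<mu>) * (\<delta> / (real (card T) + \<mu> + 1)) \<le> \<delta>"
      using \<delta> pos by (simp add: pos_divide_le_eq)
    with near[of "\<delta> / (real (card T) + \<mu> + 1)"] \<delta> pos show ?thesis by simp
  qed
  then show ?thesis unfolding S_def by (rule field_le_epsilon)
qed

subsection \<open>Edge sets\<close>

lemma smult_mat_mult_vec:
  fixes B :: "'a :: comm_ring_1 mat"
  assumes "B \<in> carrier_mat m c" "x \<in> carrier_vec c"
  shows "(a \<cdot>\<^sub>m B) *\<^sub>v x = a \<cdot>\<^sub>v (B *\<^sub>v x)"
  using assms by (intro eq_vecI) auto

text \<open>Supplies the symmetry and the quadratic form to which the Rayleigh bounds are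
  applied.\<close>

lemma gram_mat:
  fixes N :: "real mat" and a :: real
  assumes N: "N \<in> carrier_mat m c"
  defines "G \<equiv> a \<cdot>\<^sub>m (N\<^sup>T * N)"
  shows "G \<in> carrier_mat c c" "G\<^sup>T = G"
    and "x \<in> carrier_vec c \<Longrightarrow> x \<bullet> (G *\<^sub>v x) = a * ((N *\<^sub>v x) \<bullet> (N *\<^sub>v x))"
proof -
  show "G \<in> carrier_mat c c"
    using N by (simp add: G_def)
  show "G\<^sup>T = G"
    using N comm_scalar_prod[of "col N i" m "col N j" for i j]
    by (intro eq_matI) (auto simp: G_def)
  assume x: "x \<in> carrier_vec c"
  have "G *\<^sub>v x = a \<cdot>\<^sub>v (N\<^sup>T *\<^sub>v (N *\<^sub>v x))"
    using N x by (simp add: G_def smult_mat_mult_vec[of _ c c] assoc_mult_mat_vec[of _ c m _ c])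
  moreover have "x \<bullet> (N\<^sup>T *\<^sub>v (N *\<^sub>v x)) = (N *\<^sub>v x) \<bullet> (N *\<^sub>v x)"
    using transpose_vec_mult_scalar[OF N x, of "N *\<^sub>v x"] N x
      comm_scalar_prod[of x c "N\<^sup>T *\<^sub>v (N *\<^sub>v x)"] by simp
  ultimately show "x \<bullet> (G *\<^sub>v x) = a * ((N *\<^sub>v x) \<bullet> (N *\<^sub>v x))"
    using N x by simp
qed

text \<open>Together the two parts characterise \<open>lambda_min G\<close> as the best constant in
  an inequality over \<open>supp_vec l I\<close>, so that different column sets can be compared
  inside one space.\<close>

lemma lambda_min_gram_cols:
  fixes A :: "real mat" and a :: real
  assumes A: "A \<in> carrier_mat m l" and I: "I \<subseteq> {..<l}" "I \<noteq> {}"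
  defines "G \<equiv> a \<cdot>\<^sub>m ((submatrix A UNIV I)\<^sup>T * submatrix A UNIV I)"
  shows "y \<in> supp_vec l I \<Longrightarrow> lambda_min G * (y \<bullet> y) \<le> a * ((A *\<^sub>v y) \<bullet> (A *\<^sub>v y))"
    and "(\<And>y. y \<in> supp_vec l I \<Longrightarrow> c * (y \<bullet> y) \<le> a * ((A *\<^sub>v y) \<bullet> (A *\<^sub>v y))) \<Longrightarrow> c \<le> lambda_min G"
proof -
  have "finite I" using I(1) finite_subset by blast
  \<comment> \<open>Excludes the 0 x 0 matrix, whose \<open>lambda_min\<close> is
    unspecified.\<close>
  then have pos: "card I > 0" using I(2) by (simp add: card_gt_0_iff)
  note G = gram_mat[OF submatrix_cols_carrier[OF A I(1)], where a = a, folded G_def]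
  show "lambda_min G * (y \<bullet> y) \<le> a * ((A *\<^sub>v y) \<bullet> (A *\<^sub>v y))" if y: "y \<in> supp_vec l I"
    using lambda_min_rayleigh(1)[OF G(1,2) pos, of "vec (card I) (\<lambda>j. y $ pick I j)"]
    by (simp add: G(3) submatrix_cols_restrict[OF A I(1) y])
  assume le: "\<And>y. y \<in> supp_vec l I \<Longrightarrow> c * (y \<bullet> y) \<le> a * ((A *\<^sub>v y) \<bullet> (A *\<^sub>v y))"
  show "c \<le> lambda_min G"
  proof (rule lambda_min_ge[OF G(1,2) pos])
    fix x :: "real vec" assume x: "x \<in> carrier_vec (card I)"
    then obtain y where y: "y \<in> supp_vec l I" and xy: "x = vec (card I) (\<lambda>j. y $ pick I j)"
      by (rule supp_vec_extend[OF I(1)])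
    show "c * (x \<bullet> x) \<le> x \<bullet> (G *\<^sub>v x)"
      unfolding G(3)[OF x] using le[OF y] submatrix_cols_restrict[OF A I(1) y, folded xy] by simp
  qed
qed

section \<open>Edge sets as sets of column indices\<close>

definition edge_index :: "'a list \<Rightarrow> 'a set \<Rightarrow> nat set" where
  "edge_index es S = {k. k < length es \<and> es ! k \<in> S}"

lemma edge_index_subset: "edge_index es S \<subseteq> {..<length es}"
  by (auto simp: edge_index_def)

lemma bij_betw_edge_index:
  assumes "distinct es" "S \<subseteq> set es"
  shows "bij_betw ((!) es) (edge_index es S) S"
  using assms
  by (auto simp: bij_betw_def edge_index_def inj_on_def nth_eq_iff_index_eq image_iff in_set_conv_nth subset_iff)

lemma edge_index_insert:
  assumes "distinct es" "k < length es"
  shows "edge_index es (insert (es ! k) S) = insert k (edge_index es S)"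
  using assms by (auto simp: edge_index_def nth_eq_iff_index_eq)

lemma edge_index_mono: "S \<subseteq> T \<Longrightarrow> edge_index es S \<subseteq> edge_index es T"
  by (auto simp: edge_index_def)

lemma edge_index_nonempty:
  assumes "S \<subseteq> set es" "S \<noteq> {}"
  shows "edge_index es S \<noteq> {}"
  using assms by (fastforce simp: edge_index_def in_set_conv_nth)

lemma incidence_mat_carrier: "incidence_mat m es \<in> carrier_mat m (length es)"
  by (simp add: incidence_mat_def)

lemma incidence_sub_eq:
  "incidence_sub m es S = submatrix (incidence_mat m es) UNIV (edge_index es S)"
  by (simp add: incidence_sub_def edge_index_def)

text \<open>\<open>pick\<close> is the identity on an initial segment. The full matrix
  \<open>gram\<close> thereby becomes the case \<open>S = set es\<close> of
  \<open>gram_sub\<close>.\<close>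

lemma incidence_sub_all: "incidence_sub m es (set es) = incidence_mat m es"
proof -
  have "pick {..<length es} j = j" if "j < length es" for j
  proof -
    have "{a \<in> {..<length es}. a < j} = {..<j}" using that by auto
    then show ?thesis
      using pick_card_in_set[of j "{..<length es}"] that by simp
  qed
  moreover have "{k. k < length es \<and> es ! k \<in> set es} = {..<length es}" by auto
  \<comment> \<open>The column count of a submatrix counts the indices below
    \<open>length es\<close> that lie in the selected set, here again \<open>{..<length es}\<close>;
    hence the doubled condition.\<close>
  moreover have "{k. k < length es \<and> k < length es} = {..<length es}" by auto
  ultimately show ?thesis
    using incidence_mat_carrier[of m es]
    by (intro eq_matI) (auto simp: incidence_sub_def dim_submatrix submatrix_index pick_UNIV)
qed

lemma gram_sub_all: "gram_sub m es n (set es) = gram m es n"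
  by (simp add: gram_sub_def gram_def incidence_sub_all)

text \<open>Each column has one entry 1, at the smaller endpoint, one entry -1, at the larger, and
  zeros elsewhere.\<close>

lemma incidence_col_norm:
  assumes graph: "simple_graph m es" and k: "k < length es"
  shows "col (incidence_mat m es) k \<bullet> col (incidence_mat m es) k = 2"
proof -
  have edge: "es ! k \<subseteq> {..<m}" "card (es ! k) = 2"
    using graph k by (auto simp: simple_graph_def)
  then obtain a b where ab: "es ! k = {a, b}" "a < b"
    by (metis card_2_iff insert_commute linorder_neqE_nat)
  have bm: "b < m" using edge(1) ab by auto
  have entry: "incidence_mat m es $$ (i, k) = (if i = a then 1 else if i = b then - 1 else 0)"
    if "i < m" for i
    using that k ab by (auto simp: incidence_mat_def doubleton_eq_iff)
  have "col (incidence_mat m es) k \<bullet> col (incidence_mat m es) k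
      = (\<Sum>i\<in>{0..<m}. (incidence_mat m es $$ (i, k))\<^sup>2)"
    using k incidence_mat_carrier[of m es] by (simp add: scalar_prod_def power2_eq_square)
  also have "\<dots> = (\<Sum>i\<in>{0..<m}. if i \<in> {a, b} then 1 else 0)"
    by (intro sum.cong) (auto simp: entry)
  also have "\<dots> = real (card {a, b})"
  proof -
    have "{0..<m} \<inter> {a, b} = {a, b}" using ab bm by auto
    then show ?thesis using sum.inter_restrict[of "{0..<m}" "\<lambda>_. 1 :: real" "{a, b}"] by simp
  qed
  finally show ?thesis using ab by simp
qed

text \<open>Gram matrices are positive semidefinite, which gives the first part. The second has the
  shape of the coercivity hypothesis of \<open>least_squares_weak_submodular\<close>; the third
  holds because fewer coordinates mean fewer constraints on the best constant.\<close>

lemma lambda_min_gram_sub: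
  assumes S: "S \<subseteq> set es" "S \<noteq> {}" and n: "n \<ge> 1"
  shows "0 \<le> lambda_min (gram_sub m es n S)"
    and "w \<in> supp_vec (length es) (edge_index es S) \<Longrightarrow>
      2 * lambda_min (gram_sub m es n S) * (w \<bullet> w)
        \<le> (incidence_mat m es *\<^sub>v w) \<bullet> (incidence_mat m es *\<^sub>v w)"
    and "T \<subseteq> S \<Longrightarrow> T \<noteq> {} \<Longrightarrow> lambda_min (gram_sub m es n S) \<le> lambda_min (gram_sub m es n T)"
proof -
  note cols = lambda_min_gram_cols[OF incidence_mat_carrier[of m es] edge_index_subset edge_index_nonempty,
      where a = "1 / (2 * real n)", folded incidence_sub_eq, folded gram_sub_def]
  show nonneg: "0 \<le> lambda_min (gram_sub m es n S)"
    using S by (rule cols(2)) (auto intro!: divide_nonneg_nonneg scalar_prod_self_nonneg)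
  show "2 * lambda_min (gram_sub m es n S) * (w \<bullet> w)
      \<le> (incidence_mat m es *\<^sub>v w) \<bullet> (incidence_mat m es *\<^sub>v w)"
    if w: "w \<in> supp_vec (length es) (edge_index es S)"
  proof -
    \<comment> \<open>The factor \<open>n\<close> coming from the scaling \<open>1 / (2 * n)\<close>
      may be dropped, because the eigenvalue is nonnegative and \<open>n \<ge> 1\<close>.\<close>
    have "1 * (lambda_min (gram_sub m es n S) * (w \<bullet> w))
        \<le> real n * (lambda_min (gram_sub m es n S) * (w \<bullet> w))"
      using n nonneg by (intro mult_right_mono mult_nonneg_nonneg scalar_prod_self_nonneg) auto
    then show ?thesis
      using cols(1)[OF S w] n by (simp add: field_simps)
  qed
  assume T: "T \<subseteq> S" "T \<noteq> {}"
  show "lambda_min (gram_sub m es n S) \<le> lambda_min (gram_sub m es n T)"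
    using cols(1)[OF S] supp_vec_mono[OF edge_index_mono[OF T(1)]] T S by (intro cols(2)) auto
qed

section \<open>Sparse eigenvalues\<close>

text \<open>A set with at most \<open>k\<close> edges is enlarged to exactly \<open>k\<close> edges,
  which can only lower the eigenvalue. For \<open>k\<close> beyond the number of edges, the
  convention for \<open>sparse_lambda_min\<close> amounts to enlarging to all of
  \<open>set es\<close>.\<close>

lemma sparse_lambda_min_le:
  assumes T: "T \<subseteq> set es" "T \<noteq> {}" and card: "card T \<le> k" and n: "n \<ge> 1"
  shows "sparse_lambda_min m es n k \<le> lambda_min (gram_sub m es n T)"
proof (cases "k > card (set es)")
  case True
  have "set es \<noteq> {}" using T by auto
  then show ?thesis
    using lambda_min_gram_sub(3)[OF subset_refl _ n T, of m] True
    by (simp add: sparse_lambda_min_def gram_sub_all)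
next
  case False
  then obtain T' where T': "T \<subseteq> T'" "T' \<subseteq> set es" "card T' = k"
    using exists_subset_between[of T k "set es"] T card by auto
  have "finite {lambda_min (gram_sub m es n S) | S. S \<subseteq> set es \<and> card S = k}"
    by (rule finite_subset[of _ "(\<lambda>S. lambda_min (gram_sub m es n S)) ` Pow (set es)"]) auto
  then have "sparse_lambda_min m es n k \<le> lambda_min (gram_sub m es n T')"
    using False T' by (auto simp: sparse_lambda_min_def intro: Min_le)
  also have "\<dots> \<le> lambda_min (gram_sub m es n T)"
    using T T' by (intro lambda_min_gram_sub(3) n) auto
  finally show ?thesis .
qed

lemma lambda_min_gram_le_sparse:
  assumes k: "k \<ge> 1" and n: "n \<ge> 1"
  shows "lambda_min (gram m es n) \<le> sparse_lambda_min m es n k"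
proof (cases "k > card (set es)")
  case False
  let ?M = "{lambda_min (gram_sub m es n S) | S. S \<subseteq> set es \<and> card S = k}"
  have "finite ?M"
    by (rule finite_subset[of _ "(\<lambda>S. lambda_min (gram_sub m es n S)) ` Pow (set es)"]) auto
  moreover have "?M \<noteq> {}"
    using exists_subset_between[of "{}" k "set es"] False by auto
  moreover have "lambda_min (gram m es n) \<le> a" if "a \<in> ?M" for a
  proof -
    from that obtain S where S: "a = lambda_min (gram_sub m es n S)" "S \<subseteq> set es" "card S = k"
      by auto
    \<comment> \<open>Here \<open>k \<ge> 1\<close> enters: the eigenvalue comparison concerns
      nonempty edge sets.\<close>
    then have "S \<noteq> {}" "set es \<noteq> {}" using k by auto
    then show ?thesis
      using lambda_min_gram_sub(3)[OF subset_refl _ n S(2), of m] S(1) by (simp add: gram_sub_all)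
  qed
  ultimately show ?thesis
    using False by (simp add: sparse_lambda_min_def)
qed (simp add: sparse_lambda_min_def)

section \<open>Weak submodularity over edge sets\<close>

lemma least_squares_incidence_antimono:
  assumes "S \<subseteq> T"
  shows "least_squares (incidence_sub m es T) b \<le> least_squares (incidence_sub m es S) b"
  unfolding incidence_sub_eq
  by (rule least_squares_cols_antimono[OF incidence_mat_carrier edge_index_subset edge_index_mono[OF assms]])

lemma least_squares_incidence_weak_submodular:
  assumes graph: "simple_graph m es" and n: "n \<ge> 1"
    and LS: "L \<subseteq> set es" "S \<subseteq> set es" "L \<union> S \<noteq> {}"
    and b: "b \<in> carrier_vec m"
  defines "f \<equiv> \<lambda>S. least_squares (incidence_sub m es S) b"
  shows "lambda_min (gram_sub m es n (L \<union> S)) * (f L - f (L \<union> S))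
    \<le> (\<Sum>z\<in>S. f L - f (L \<union> {z}))"
proof -
  have distinct: "distinct es" using graph by (simp add: simple_graph_def)
  have T: "L \<union> S \<subseteq> set es" using LS by auto
  have "edge_index es L \<subseteq> edge_index es (L \<union> S)"
    by (rule edge_index_mono) simp
  from least_squares_weak_submodular[OF incidence_mat_carrier edge_index_subset this b
      incidence_col_norm[OF graph] lambda_min_gram_sub(1,2)[OF T LS(3) n]]
  have "lambda_min (gram_sub m es n (L \<union> S)) * (f L - f (L \<union> S))
      \<le> (\<Sum>k\<in>edge_index es (L \<union> S). f L
          - least_squares (submatrix (incidence_mat m es) UNIV (insert k (edge_index es L))) b)"
    by (simp add: f_def incidence_sub_eq)
  also have "\<dots> = (\<Sum>k\<in>edge_index es (L \<union> S). f L - f (L \<union> {es ! k}))"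
  proof (rule sum.cong[OF refl])
    fix k assume "k \<in> edge_index es (L \<union> S)"
    then have "k < length es" by (simp add: edge_index_def)
    from edge_index_insert[OF distinct this, of L]
    show "f L - least_squares (submatrix (incidence_mat m es) UNIV (insert k (edge_index es L))) b
        = f L - f (L \<union> {es ! k})"
      by (simp add: f_def incidence_sub_eq)
  qed
  also have "\<dots> = (\<Sum>z\<in>L \<union> S. f L - f (L \<union> {z}))"
    by (rule sum.reindex_bij_betw[OF bij_betw_edge_index[OF distinct T]])
  \<comment> \<open>An edge already in \<open>L\<close> yields no gain.\<close>
  also have "\<dots> = (\<Sum>z\<in>S. f L - f (L \<union> {z}))"
    using T by (intro sum.mono_neutral_right) (auto simp: insert_absorb dest: finite_subset)
  finally show ?thesis .
qed

text \<open>The eigenvalue factor is the same for every target vector, so the inequalities for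
  \<open>b0\<close> and all \<open>c i\<close> add up with the nonnegative weights \<xi> and
  1.\<close>

lemma cost_weak_submodular:
  assumes graph: "simple_graph m es" and n: "n \<ge> 1" and \<xi>: "\<xi> \<ge> 0"
    and b0: "b0 \<in> carrier_vec m" and c: "\<And>i. c i \<in> carrier_vec m"
    and LS: "L \<subseteq> set es" "S \<subseteq> set es" "L \<union> S \<noteq> {}"
  defines "J \<equiv> cost m es n \<xi> b0 c"
  shows "lambda_min (gram_sub m es n (L \<union> S)) * (J L - J (L \<union> S)) \<le> (\<Sum>z\<in>S. J L - J (L \<union> {z}))"
proof -
  let ?\<mu> = "lambda_min (gram_sub m es n (L \<union> S))"
  define f where "f b S = least_squares (incidence_sub m es S) b" for b S
  have f: "?\<mu> * (f b L - f b (L \<union> S)) \<le> (\<Sum>z\<in>S. f b L - f b (L \<union> {z}))"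
    if "b \<in> carrier_vec m" for b
    unfolding f_def by (rule least_squares_incidence_weak_submodular[OF graph n LS that])
  have J: "J L - J T = \<xi> * (f b0 L - f b0 T) + (\<Sum>i<n. f (c i) L - f (c i) T)" for T
    by (simp add: J_def cost_def f_def sum_subtractf algebra_simps)
  have "?\<mu> * (J L - J (L \<union> S)) = \<xi> * (?\<mu> * (f b0 L - f b0 (L \<union> S)))
      + (\<Sum>i<n. ?\<mu> * (f (c i) L - f (c i) (L \<union> S)))"
    unfolding J by (simp add: distrib_left sum_distrib_left)
  also have "\<dots> \<le> \<xi> * (\<Sum>z\<in>S. f b0 L - f b0 (L \<union> {z}))
      + (\<Sum>i<n. \<Sum>z\<in>S. f (c i) L - f (c i) (L \<union> {z}))"
    by (intro add_mono mult_left_mono sum_mono f b0 c \<xi>)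
  also have "\<dots> = (\<Sum>z\<in>S. J L - J (L \<union> {z}))"
    unfolding J by (simp add: sum.distrib sum_distrib_left sum.swap[of _ "{..<n}"])
  finally show ?thesis .
qed

text \<open>Settles the sign of the denominators in the submodularity ratio.\<close>

lemma cost_antimono:
  assumes "\<xi> \<ge> 0" "S \<subseteq> T"
  shows "cost m es n \<xi> b0 c T \<le> cost m es n \<xi> b0 c S"
  unfolding cost_def
  by (intro add_mono mult_left_mono sum_mono least_squares_incidence_antimono assms)

theorem theorem1:
  fixes m n r k :: nat
    and es :: "nat set list"
    and u ref :: "nat \<Rightarrow> nat"
    and W L :: "real mat"
    and d0 g0 :: "real vec"
    and \<xi> :: real
    and U :: "nat set set"
    and J :: "nat set set \<Rightarrow> real"
  assumes graph: "simple_graph m es"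
    and n: "n \<ge> 1"
    and gen_buses: "\<forall>i<n. u i < m"
    and refs: "\<forall>k<r. ref k < n"
    and ref_buses: "inj_on (\<lambda>k. u (ref k)) {..<r}"
    and L: "coherency_mat n r ref W L"
    and d0: "d0 \<in> carrier_vec m"
    and g0: "g0 \<in> carrier_vec m"
    and \<xi>: "\<xi> \<ge> 0"
    and J: "J = cost m es n \<xi> (d0 - g0) (coherency_vec m r u ref L)"
    and U: "U \<subseteq> set es"
    and k: "k \<ge> 1"
  shows "submodularity_ratio (set es) J U k \<ge> ereal (sparse_lambda_min m es n (k + card U)) \<and>
         sparse_lambda_min m es n (k + card U) \<ge> lambda_min (gram m es n)"
proof
  show "sparse_lambda_min m es n (k + card U) \<ge> lambda_min (gram m es n)"
    using k n by (intro lambda_min_gram_le_sparse) auto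
  have b0: "d0 - g0 \<in> carrier_vec m"
    using d0 g0 by simp
  have c: "coherency_vec m r u ref L i \<in> carrier_vec m" for i
    by (simp add: coherency_vec_def)
  have "sparse_lambda_min m es n (k + card U)
      \<le> (\<Sum>z\<in>S. J (X \<union> {z}) - J X) / (J (X \<union> S) - J X)"
    if X: "X \<subseteq> U" and S: "S \<subseteq> set es" "card S \<le> k"
      and ne: "J (X \<union> S) - J X \<noteq> 0" for X S
  proof -
    let ?\<mu> = "lambda_min (gram_sub m es n (X \<union> S))"
    \<comment> \<open>If \<open>X \<union> S\<close> were empty, then \<open>X\<close> would be
      empty too and the denominator would be zero.\<close>
    have XS: "X \<subseteq> set es" "X \<union> S \<noteq> {}"
      using X U ne by auto
    have "finite U" using U finite_subset by blast
    then have "card (X \<union> S) \<le> k + card U"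
      using card_Un_le[of X S] card_mono[OF _ X] S(2) by linarith
    then have "sparse_lambda_min m es n (k + card U) \<le> ?\<mu>"
      using XS S n by (intro sparse_lambda_min_le) auto
    also have "?\<mu> \<le> (\<Sum>z\<in>S. J X - J (X \<union> {z})) / (J X - J (X \<union> S))"
    proof -
      have "J (X \<union> S) \<le> J X"
        unfolding J by (rule cost_antimono[OF \<xi>]) simp
      then have "J X - J (X \<union> S) > 0" using ne by simp
      then show ?thesis
        using cost_weak_submodular[OF graph n \<xi> b0, where c = "coherency_vec m r u ref L", OF c XS(1) S(1) XS(2), folded J]
        by (simp add: pos_le_divide_eq)
    qed
    \<comment> \<open>Adding edges lowers \<open>J\<close>, so the numerator and the denominator of
      the defining ratio are the negatives of the gains used above.\<close>
    also have "\<dots> = (\<Sum>z\<in>S. J (X \<union> {z}) - J X) / (J (X \<union> S) - J X)"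
    proof -
      have "(\<Sum>z\<in>S. J X - J (X \<union> {z})) = - (\<Sum>z\<in>S. J (X \<union> {z}) - J X)"
        by (simp flip: sum_negf)
      then show ?thesis
        using ne by (simp add: field_simps)
    qed
    finally show ?thesis .
  qed
  \<comment> \<open>If no pair has a nonzero denominator, the infimum is \<infinity> and the bound
    is trivial.\<close>
  then show "submodularity_ratio (set es) J U k \<ge> ereal (sparse_lambda_min m es n (k + card U))"
    unfolding submodularity_ratio_def by (intro INF_greatest) auto
qed

end
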